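(* Let $n$ and $m$ be positive integers. If $G_{n,m,2}$ has exactly one diagonal, then $G_{2n,2m,2}$ is Hamiltonian.
   Context: For positive integers $n,m$, the graph $G_{n,m,2}$ (an augmented directed grid graph on a two-holed torus) is defined as follows. Its vertices are the $4nm$ cells $(i,c)$ of a grid with $2n$ rows $0\le i<2n$ (row $0$ on top) and $2m$ columns $0\le c<2m$ (column $0$ leftmost). The bijection $u$ ("up") on cells is $u(i,c)=(i-1,c)$ if $i\ge 1$, and $u(0,c)=(2n-1,(c+m)\bmod 2m)$. The bijection $r$ ("right") on cells is $r(i,c)=(i,c+1)$ if $c<2m-1$, and $r(i,2m-1)=((i+n)\bmod 2n,0)$. The directed edges are $(\alpha,u\alpha)$ and $(\alpha,r\alpha)$ for every cell $\alpha$. A diagonal is a set $\{\alpha,u^{-1}r\alpha,(u^{-1}r)^2\alpha,\dots\}$ for a cell $\alpha$, i.e. an orbit of the permutation $u^{-1}r$ (apply $r$ first, then $u^{-1}$) on cells. A directed graph is Hamiltonian if it has a directed cycle visiting every vertex exactly once. *)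

theory Defs
  imports "Graph_Theory.Pair_Digraph"
begin

definition cells :: "nat \<Rightarrow> nat \<Rightarrow> (nat \<times> nat) set" where
  "cells n m = {..<2 * n} \<times> {..<2 * m}"

fun up :: "nat \<Rightarrow> nat \<Rightarrow> nat \<times> nat \<Rightarrow> nat \<times> nat" where
  "up n m (i, c) = (if i \<ge> 1 then (i - 1, c) else (2 * n - 1, (c + m) mod (2 * m)))"

fun right :: "nat \<Rightarrow> nat \<Rightarrow> nat \<times> nat \<Rightarrow> nat \<times> nat" where
  "right n m (i, c) = (if c < 2 * m - 1 then (i, c + 1) else ((i + n) mod (2 * n), 0))"

lemma bij_betw_up:
  assumes "n \<ge> 1" "m \<ge> 1"
  shows "bij_betw (up n m) (cells n m) (cells n m)"
proof (rule bij_betw_byWitness)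
  let ?f = "\<lambda>(i, c). if i < 2 * n - 1 then (i + 1, c) else (0, (c + m) mod (2 * m))"
  have *: "((c + m) mod (2 * m) + m) mod (2 * m) = c" if "c < 2 * m" for c
    using that by (simp add: mod_simps add.assoc flip: mult_2)
  show "\<forall>a\<in>cells n m. ?f (up n m a) = a" "\<forall>a\<in>cells n m. up n m (?f a) = a"
    using assms * by (auto simp: cells_def)
  show "up n m ` cells n m \<subseteq> cells n m" "?f ` cells n m \<subseteq> cells n m"
    using assms by (auto simp: cells_def split: if_splits)
qed

lemma bij_betw_right:
  assumes "n \<ge> 1" "m \<ge> 1"
  shows "bij_betw (right n m) (cells n m) (cells n m)"
proof (rule bij_betw_byWitness)
  let ?f = "\<lambda>(i, c). if c \<ge> 1 then (i, c - 1) else ((i + n) mod (2 * n), 2 * m - 1)"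
  have *: "((i + n) mod (2 * n) + n) mod (2 * n) = i" if "i < 2 * n" for i
    using that by (simp add: mod_simps add.assoc flip: mult_2)
  show "\<forall>a\<in>cells n m. ?f (right n m a) = a" "\<forall>a\<in>cells n m. right n m (?f a) = a"
    using assms * by (auto simp: cells_def)
  show "right n m ` cells n m \<subseteq> cells n m" "?f ` cells n m \<subseteq> cells n m"
    using assms by (auto simp: cells_def split: if_splits)
qed

text \<open>Parallel arcs are identified; this only matters for \<open>n = m = 1\<close>.\<close>

definition torus_grid :: "nat \<Rightarrow> nat \<Rightarrow> (nat \<times> nat) pair_pre_digraph" where
  "torus_grid n m =
    \<lparr>pverts = cells n m,
     parcs = (\<lambda>\<alpha>. (\<alpha>, up n m \<alpha>)) ` cells n m \<union> (\<lambda>\<alpha>. (\<alpha>, right n m \<alpha>)) ` cells n m\<rparr>"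

text \<open>The inverse of \<open>up\<close> is taken as a bijection of the cells, not of all pairs of naturals.\<close>

definition diag_step :: "nat \<Rightarrow> nat \<Rightarrow> nat \<times> nat \<Rightarrow> nat \<times> nat" where
  "diag_step n m \<alpha> = inv_into (cells n m) (up n m) (right n m \<alpha>)"

definition diagonals :: "nat \<Rightarrow> nat \<Rightarrow> (nat \<times> nat) set set" where
  "diagonals n m = (\<lambda>\<alpha>. {(diag_step n m ^^ k) \<alpha> | k. True}) ` cells n m"

text \<open>
  The vertices of a cycle are exactly the tails of its arcs, and they are pairwise distinct by
  the definition of \<^const>\<open>pre_digraph.cycle\<close>.
\<close>

definition hamiltonian :: "('a, 'b) pre_digraph \<Rightarrow> bool" where
  "hamiltonian G \<longleftrightarrow> (\<exists>p. pre_digraph.cycle G p \<and> tail G ` set p = verts G)"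

end

theory Submission
  imports Defs "HOL-Combinatorics.Orbits"
begin

text \<open>
  A Hamiltonian cycle selects one of \<open>u\<close>, \<open>r\<close> at every cell, constantly along diagonals. Splitting
  every cell into four turns the single diagonal of the small grid into two diagonals of the large
  one, namely the two parity classes of \<open>i + c\<close>. We go up on the even cells and right on the odd
  ones. Four steps of this zigzag take the top left quarter of \<open>\<alpha>\<close> to the top left quarter of
  \<open>r (u \<alpha>)\<close>, so it suffices that \<open>r \<circ> u\<close> is cyclic on the small grid. The left-right reflection
  of the grid fixes \<open>u\<close> and inverts \<open>r\<close>, hence conjugates \<open>u\<^sup>-\<^sup>1 \<circ> r\<close>, which is cyclic by assumption,
  to the inverse of \<open>r \<circ> u\<close>.
\<close>

text \<open>The start \<open>i\<close> is arbitrary because the induction on the length removes the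
  first arc.\<close>

lemma pcas_map_upt:
  "pcas (h i) (map (\<lambda>k. (h k, h (Suc k))) [i..<i + N]) v \<longleftrightarrow> h (i + N) = v"
proof (induction N arbitrary: i)
  case (Suc N)
  show ?case
    using Suc[of "Suc i"] by (simp add: upt_conv_Cons del: upt_Suc)
qed simp

text \<open>Following the arcs from \<open>x\<close> to \<open>f x\<close> from any start until its
  first return traces the cycle.\<close>

lemma hamiltonian_if_cyclic_on:
  assumes cyc: "cyclic_on f (pverts G)"
    and arc: "\<And>x. x \<in> pverts G \<Longrightarrow> (x, f x) \<in> parcs G"
  shows "hamiltonian (with_proj G)"
proof -
  interpret pre_digraph "with_proj G" .
  obtain s where s: "s \<in> pverts G" and V: "pverts G = orbit f s"
    using cyc by (auto simp: cyclic_on_def)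
  \<comment> \<open>The first positive return time to \<open>s\<close>: \<open>h N = s\<close>, and
    \<open>h\<close> is injective before \<open>N\<close>.\<close>
  define N where "N = funpow_dist1 f s s"
  define h where "h k = (f ^^ k) s" for k
  define p where "p = map (\<lambda>k. (h k, h (Suc k))) [0..<N]"
  have ss: "s \<in> orbit f s" using s V by simp
  have N: "N > 0" by (simp add: N_def)
  have hN: "h N = s"
    unfolding h_def N_def by (rule funpow_dist1_prop[OF ss])
  have inj: "inj_on h {0..<N}"
    unfolding h_def N_def by (rule inj_on_funpow_dist1[OF ss])
  have img: "h ` {0..<N} = pverts G"
    unfolding h_def N_def V by (rule orbit_conv_funpow_dist1[OF ss, symmetric])
  have walk: "cas s p s"
    unfolding cas_with_proj_eq p_def using pcas_map_upt[of h 0 N s] hN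
    by (simp add: h_def)
  have "set p \<subseteq> parcs G"
    using arc img by (auto simp: p_def h_def)
  with walk s have "awalk s p s" by (simp add: awalk_def)
  moreover have "p \<noteq> []" using N by (simp add: p_def)
  moreover have "distinct (tl (awalk_verts s p))"
  proof -
    \<comment> \<open>Dropping the initial \<open>s\<close> leaves \<open>h 1\<close>, ...,
      \<open>h N\<close>. Since \<open>h N = h 0\<close>, this is a rotation of the distinct list
      \<open>h 0\<close>, ..., \<open>h (N - 1)\<close>.\<close>
    have "tl (awalk_verts s p) = map h [1..<Suc N]"
      using awalk_verts_conv'[OF walk] \<open>p \<noteq> []\<close>
      by (simp add: p_def o_def flip: map_Suc_upt del: upt_Suc)
    also have "\<dots> = map h [1..<N] @ [h 0]"
      using N hN by (simp add: h_def)
    finally have "tl (awalk_verts s p) = map h [1..<N] @ [h 0]" .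
    moreover have "distinct (map h [0..<N])"
      using inj by (simp add: distinct_map)
    then have "distinct (h 0 # map h [1..<N])"
      using N by (simp add: upt_conv_Cons)
    ultimately show ?thesis by simp
  qed
  moreover have "tail (with_proj G) ` set p = verts (with_proj G)"
    using img by (auto simp: p_def image_image)
  ultimately show ?thesis
    unfolding hamiltonian_def cycle_def by blast
qed

text \<open>Under \<open>h\<close>, an \<open>f\<close>-path from \<open>x\<close> to
  \<open>y\<close> becomes a \<open>g\<close>-path from \<open>h y\<close> back to
  \<open>h x\<close>.\<close>

lemma cyclic_on_image_inverse:
  assumes cyc: "cyclic_on f S" and inv: "\<And>x. x \<in> S \<Longrightarrow> g (h (f x)) = h x"
  shows "cyclic_on g (h ` S)"
proof -
  obtain s where s: "s \<in> S" using cyc by (auto simp: cyclic_on_def)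
  have S: "orbit f x = S" if "x \<in> S" for x
    using that cyc by (simp add: cyclic_on_alldef)
  have rev: "h x \<in> orbit g (h y)" if "x \<in> S" "y \<in> orbit f x" for x y
    using that(2)
  proof induction
    case base
    show ?case using orbit.base[of g "h (f x)"] inv[OF that(1)] by simp
  next
    case (step y)
    then have "h y \<in> orbit g (h (f y))"
      using orbit.base[of g "h (f y)"] inv[of y] S[OF that(1)] by simp
    with step.IH show ?case by (rule orbit_trans)
  qed
  have closed: "g y \<in> h ` S" if y: "y \<in> h ` S" for y
  proof -
    obtain x where x: "x \<in> S" "y = h x" using y by auto
    \<comment> \<open>Orbits consist of positive iterates, so \<open>x\<close> has an
      \<open>f\<close>-predecessor, and \<open>g\<close> sends \<open>h x\<close> to the image of
      that predecessor.\<close>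
    then have "x \<in> orbit f s" using S[OF s] by simp
    then show ?thesis
      by cases (use x s inv S[OF s] in auto)
  qed
  have "y \<in> h ` S" if "y \<in> orbit g (h s)" for y
    using that by induction (use s closed in auto)
  moreover have "h ` S \<subseteq> orbit g (h s)"
    using rev S s by blast
  ultimately show ?thesis using s unfolding cyclic_on_def by blast
qed

lemma up_in_cells: "n \<ge> 1 \<Longrightarrow> m \<ge> 1 \<Longrightarrow> \<alpha> \<in> cells n m \<Longrightarrow> up n m \<alpha> \<in> cells n m"
  and right_in_cells: "n \<ge> 1 \<Longrightarrow> m \<ge> 1 \<Longrightarrow> \<alpha> \<in> cells n m \<Longrightarrow> right n m \<alpha> \<in> cells n m"
  using bij_betw_apply[OF bij_betw_up] bij_betw_apply[OF bij_betw_right] by blast+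

lemma up_diag_step:
  assumes "n \<ge> 1" "m \<ge> 1" "\<alpha> \<in> cells n m"
  shows "up n m (diag_step n m \<alpha>) = right n m \<alpha>" "diag_step n m \<alpha> \<in> cells n m"
proof -
  have "right n m \<alpha> \<in> up n m ` cells n m"
    using right_in_cells[OF assms] bij_betw_up[OF assms(1,2)] by (simp add: bij_betw_def)
  then show "up n m (diag_step n m \<alpha>) = right n m \<alpha>" "diag_step n m \<alpha> \<in> cells n m"
    unfolding diag_step_def by (rule f_inv_into_f, rule inv_into_into)
qed

lemma cyclic_on_diag_step:
  assumes "n \<ge> 1" "m \<ge> 1" "card (diagonals n m) = 1"
  shows "cyclic_on (diag_step n m) (cells n m)"
proof -
  let ?d = "diag_step n m"
  obtain D where D: "diagonals n m = {D}" using assms(3) by (auto simp: card_1_singleton_iff)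
  have orb: "{(?d ^^ k) \<alpha> | k. True} = D" if "\<alpha> \<in> cells n m" for \<alpha>
    using imageI[OF that, of "\<lambda>\<alpha>. {(?d ^^ k) \<alpha> | k. True}"] D
    unfolding diagonals_def by simp
  have reach: "\<exists>k. \<beta> = (?d ^^ k) \<alpha>" if "\<alpha> \<in> cells n m" "\<beta> \<in> cells n m" for \<alpha> \<beta>
  proof -
    have "\<beta> = (?d ^^ 0) \<beta>" by simp
    then have "\<beta> \<in> D" using orb[OF that(2)] by blast
    then show ?thesis using orb[OF that(1)] by blast
  qed
  have in_cells: "?d \<alpha> \<in> cells n m" if "\<alpha> \<in> cells n m" for \<alpha>
    using up_diag_step(2) assms that by blast
  have z: "(0, 0) \<in> cells n m" using assms by (simp add: cells_def)
  have "\<beta> \<in> orbit ?d (0, 0)" if \<beta>: "\<beta> \<in> cells n m" for \<beta>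
  proof -
    \<comment> \<open>Diagonals allow \<open>k = 0\<close>, whereas \<open>orbit\<close> needs a
      positive iterate. Hence the path starts one step later, at \<open>?d (0, 0)\<close>.\<close>
    obtain k where "\<beta> = (?d ^^ k) (?d (0, 0))"
      using reach[OF in_cells[OF z] \<beta>] by blast
    then have "\<beta> = (?d ^^ Suc k) (0, 0)" by (simp only: funpow_Suc_right o_apply)
    then show ?thesis unfolding orbit_altdef by blast
  qed
  moreover have "\<beta> \<in> cells n m" if "\<beta> \<in> orbit ?d (0, 0)" for \<beta>
    using that by induction (use z in_cells in auto)
  ultimately show ?thesis using z unfolding cyclic_on_def by blast
qed

definition reflect :: "nat \<Rightarrow> nat \<times> nat \<Rightarrow> nat \<times> nat" where
  "reflect m = (\<lambda>(i, c). (i, 2 * m - 1 - c))"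

lemma reflect_image_cells: "m \<ge> 1 \<Longrightarrow> reflect m ` cells n m = cells n m"
  by (rule bij_betw_imp_surj_on, rule bij_betw_byWitness[where f' = "reflect m"])
    (auto simp: reflect_def cells_def)

text \<open>Reflection reverses the column shift by \<open>m\<close> at the top row, but
  \<open>m\<close> and \<open>-m\<close> agree modulo \<open>2 * m\<close>.\<close>

lemma up_reflect:
  assumes "m \<ge> 1" "\<alpha> \<in> cells n m"
  shows "up n m (reflect m \<alpha>) = reflect m (up n m \<alpha>)"
proof -
  obtain i c where \<alpha>: "\<alpha> = (i, c)" "c < 2 * m" using assms by (auto simp: cells_def)
  have "(2 * m - 1 - c + m) mod (2 * m) = 2 * m - 1 - (c + m) mod (2 * m)"
    using \<alpha>(2) by (cases "c < m") (auto simp: le_mod_geq)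
  then show ?thesis by (simp add: \<alpha> reflect_def)
qed

text \<open>Mirrored, a step right is undone by a step right. If it wraps, so does the second one,
  and the two row shifts by \<open>n\<close> cancel modulo \<open>2 * n\<close>.\<close>

lemma right_reflect_right:
  assumes "m \<ge> 1" "\<alpha> \<in> cells n m"
  shows "right n m (reflect m (right n m \<alpha>)) = reflect m \<alpha>"
proof -
  obtain i c where \<alpha>: "\<alpha> = (i, c)" "i < 2 * n" "c < 2 * m" using assms by (auto simp: cells_def)
  have "((i + n) mod (2 * n) + n) mod (2 * n) = i"
    using \<alpha>(2) by (simp add: mod_simps add.assoc flip: mult_2)
  then show ?thesis using \<alpha> by (auto simp: reflect_def)
qed

lemma cyclic_on_right_up:
  assumes "n \<ge> 1" "m \<ge> 1" "card (diagonals n m) = 1"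
  shows "cyclic_on (right n m \<circ> up n m) (cells n m)"
proof -
  \<comment> \<open>Moving \<open>up\<close> past the reflection turns \<open>up\<close> of the
    diagonal step into \<open>right n m \<alpha>\<close>; the outer \<open>right\<close> then
    cancels this one.\<close>
  have "(right n m \<circ> up n m) (reflect m (diag_step n m \<alpha>)) = reflect m \<alpha>"
    if "\<alpha> \<in> cells n m" for \<alpha>
    using that assms by (simp add: up_reflect up_diag_step right_reflect_right)
  then show ?thesis
    using cyclic_on_image_inverse[OF cyclic_on_diag_step[OF assms]]
    by (metis reflect_image_cells[OF assms(2)])
qed

definition zigzag :: "nat \<Rightarrow> nat \<Rightarrow> nat \<times> nat \<Rightarrow> nat \<times> nat" where
  "zigzag n m \<alpha> = (if even (fst \<alpha> + snd \<alpha>) then up n m \<alpha> else right n m \<alpha>)"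

definition quarter :: "nat \<Rightarrow> nat \<Rightarrow> nat \<times> nat \<Rightarrow> nat \<times> nat" where
  "quarter a b = (\<lambda>(i, c). (2 * i + a, 2 * c + b))"

lemma double_add_mod_double: "(2 * c + 2 * m) mod (4 * m) = 2 * ((c + m) mod (2 * m))"
  for c m :: nat
  using mult_mod_right[of 2 "c + m" "2 * m"] by (simp add: algebra_simps)

text \<open>The parity of a quarter is that of \<open>a + b\<close>. Two of the moves stay inside
  the block of \<alpha>; the other two cross its top or right border, where the wrap shifts of the
  large grid are twice those of the small one.\<close>

lemma zigzag_quarter:
  assumes "n \<ge> 1" "m \<ge> 1" "\<alpha> \<in> cells n m"
  shows "zigzag (2 * n) (2 * m) (quarter 0 0 \<alpha>) = quarter 1 0 (up n m \<alpha>)"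
    and "zigzag (2 * n) (2 * m) (quarter 1 0 \<alpha>) = quarter 1 1 \<alpha>"
    and "zigzag (2 * n) (2 * m) (quarter 1 1 \<alpha>) = quarter 0 1 \<alpha>"
    and "zigzag (2 * n) (2 * m) (quarter 0 1 \<alpha>) = quarter 0 0 (right n m \<alpha>)"
  using assms
  by (auto simp: zigzag_def quarter_def cells_def double_add_mod_double split: if_splits)

lemma cells_double_cases:
  assumes "x \<in> cells (2 * n) (2 * m)"
  obtains \<alpha> a b where "\<alpha> \<in> cells n m" "a \<in> {0, 1}" "b \<in> {0, 1}" "x = quarter a b \<alpha>"
proof -
  obtain i c where x: "x = (i, c)" "i < 4 * n" "c < 4 * m" using assms by (auto simp: cells_def)
  show ?thesis
  proof (rule that)
    show "x = quarter (i mod 2) (c mod 2) (i div 2, c div 2)" by (simp add: x quarter_def)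
  qed (use x in \<open>auto simp: cells_def\<close>)
qed

lemma cyclic_on_zigzag:
  assumes nm: "n \<ge> 1" "m \<ge> 1" and cyc: "cyclic_on (right n m \<circ> up n m) (cells n m)"
  shows "cyclic_on (zigzag (2 * n) (2 * m)) (cells (2 * n) (2 * m))"
proof -
  let ?F = "right n m \<circ> up n m" and ?f = "zigzag (2 * n) (2 * m)"
  let ?O = "orbit ?f (0, 0)"
  have z: "(0, 0) \<in> cells n m" and Z: "(0, 0) \<in> cells (2 * n) (2 * m)"
    using nm by (auto simp: cells_def)
  note zz = zigzag_quarter[OF nm]
  note cl = up_in_cells[OF nm] right_in_cells[OF nm]
  have orb: "orbit ?F (0, 0) = cells n m" by (rule orbit_cyclic_eq3[OF cyc z])
  have four: "?f (?f (?f (?f (quarter 0 0 \<alpha>)))) = quarter 0 0 (?F \<alpha>)" if "\<alpha> \<in> cells n m" for \<alpha>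
    using that by (simp add: zz cl del: One_nat_def)
  have 00: "quarter 0 0 \<alpha> \<in> ?O" if "\<alpha> \<in> cells n m" for \<alpha>
    using that[folded orb]
  proof induction
    \<comment> \<open>The orbit of \<open>?F\<close> begins at \<open>?F (0, 0)\<close>, which the
      zigzag reaches after four steps.\<close>
    case base
    have "?f (?f (?f (?f (quarter 0 0 (0, 0))))) \<in> orbit ?f (quarter 0 0 (0, 0))"
      by (intro orbit.intros)
    then show ?case unfolding four[OF z] by (simp add: quarter_def)
  next
    case (step \<alpha>)
    then have "?f (?f (?f (?f (quarter 0 0 \<alpha>)))) \<in> ?O" by (intro orbit.intros)
    then show ?case using step.hyps orb four by auto
  qed
  have 10: "quarter 1 0 \<alpha> \<in> ?O" if \<alpha>: "\<alpha> \<in> cells n m" for \<alpha>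
  proof -
    \<comment> \<open>A lower left quarter is entered from the top left quarter of the cell below,
      which exists as \<open>up\<close> is onto.\<close>
    obtain \<beta> where "\<beta> \<in> cells n m" "up n m \<beta> = \<alpha>"
      using bij_betw_up[OF nm] \<alpha> by (metis bij_betw_imp_surj_on imageE)
    then show ?thesis using orbit.step[OF 00] zz(1) by metis
  qed
  have 11: "quarter 1 1 \<alpha> \<in> ?O" if "\<alpha> \<in> cells n m" for \<alpha>
    using orbit.step[OF 10[OF that]] zz(2) that by simp
  have 01: "quarter 0 1 \<alpha> \<in> ?O" if "\<alpha> \<in> cells n m" for \<alpha>
    using orbit.step[OF 11[OF that]] zz(3) that by simp
  have closed: "?f x \<in> cells (2 * n) (2 * m)" if "x \<in> cells (2 * n) (2 * m)" for x
    using that nm up_in_cells right_in_cells by (simp add: zigzag_def)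
  have "x \<in> ?O" if "x \<in> cells (2 * n) (2 * m)" for x
    using that by (rule cells_double_cases) (use 00 01 10 11 in auto)
  moreover have "x \<in> cells (2 * n) (2 * m)" if "x \<in> ?O" for x
    using that by induction (use Z closed in auto)
  ultimately show ?thesis using Z unfolding cyclic_on_def by blast
qed

theorem proposition13:
  fixes n m :: nat
  assumes "n \<ge> 1" and "m \<ge> 1"
    and "card (diagonals n m) = 1"
  shows "hamiltonian (with_proj (torus_grid (2 * n) (2 * m)))"
proof (rule hamiltonian_if_cyclic_on)
  show "cyclic_on (zigzag (2 * n) (2 * m)) (pverts (torus_grid (2 * n) (2 * m)))"
    using cyclic_on_zigzag[OF assms(1,2) cyclic_on_right_up[OF assms]]
    by (simp add: torus_grid_def)
qed (auto simp: torus_grid_def zigzag_def)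

end
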